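(* Let $G\neq 1$ be a finite group with a metric $d_G$. For each $n\ge1$ let $G_n=G\times\cdots\times G$ ($n$ factors) be equipped with the $l_1$ metric $d_n((x_i),(y_i))=\sum_{i=1}^n d_G(x_i,y_i)$. Then the coarse disjoint union $X=\bigcup_{n\ge1} G_n$ is not coarsely amenable. In particular, the Hilbert space is not coarsely amenable.
   Context: The Hilbert space means the infinite-dimensional separable Hilbert space with its norm metric. The coarse disjoint union of a sequence $\{(X_n,d_n)\}$ of bounded metric spaces is the disjoint union of all $X_n$ with the metric $d$ given by $d=d_n$ on $X_n\times X_n$ and $d(x,y)=\operatorname{diam}(X_i)+\operatorname{diam}(X_j)$ if $x\in X_i$, $y\in X_j$, $i\ne j$. In a metric space $X$, $B(x,r)=\{y:d(x,y)<r\}$. A cover of $X$ is an indexed family $\mathcal{U}=\{U_s\}_{s\in S}$ of subsets with union $X$ (counted with multiplicity); it is uniformly bounded if there is $r<\infty$ with $d(x,y)<r$ whenever $x,y$ lie in the same element. For $A\subset X$, $\operatorname{hor}(A,\mathcal{U})=\{s\in S: A\cap U_s\neq\emptyset\}$. $X$ is coarsely amenable if for each $s>r>0$ and each $\epsilon>0$ there is a uniformly bounded cover $\mathcal{U}$ of $X$ such that for each $x\in X$ the set $\operatorname{hor}(B(x,s),\mathcal{U})$ is finite and $\frac{|\operatorname{hor}(B(x,r),\mathcal{U})|}{|\operatorname{hor}(B(x,s),\mathcal{U})|}>1-\epsilon$. *)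

theory Defs
  imports "HOL-Analysis.Analysis" "HOL-Algebra.Product_Groups"
begin

section \<open>Coarse amenability\<close>

context Metric_space
begin

text \<open>A cover is an indexed family \<open>U i\<close>, \<open>i \<in> I\<close>; multiplicities matter, so \<open>hor\<close> is a set of
  indices rather than a set of members.\<close>

definition indexed_cover :: "'i set \<Rightarrow> ('i \<Rightarrow> 'a set) \<Rightarrow> bool"
  where "indexed_cover I U \<longleftrightarrow> (\<Union>i\<in>I. U i) = M"

definition uniformly_bounded :: "'i set \<Rightarrow> ('i \<Rightarrow> 'a set) \<Rightarrow> bool"
  where "uniformly_bounded I U \<longleftrightarrow> (\<exists>R. \<forall>i\<in>I. \<forall>x\<in>U i. \<forall>y\<in>U i. d x y < R)"

definition hor :: "'a set \<Rightarrow> 'i set \<Rightarrow> ('i \<Rightarrow> 'a set) \<Rightarrow> 'i set"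
  where "hor A I U = {i \<in> I. A \<inter> U i \<noteq> {}}"

definition amenability_cover :: "real \<Rightarrow> real \<Rightarrow> real \<Rightarrow> 'i set \<Rightarrow> ('i \<Rightarrow> 'a set) \<Rightarrow> bool"
  where "amenability_cover r s \<epsilon> I U \<longleftrightarrow>
    indexed_cover I U \<and> uniformly_bounded I U \<and>
    (\<forall>x\<in>M. finite (hor (mball x s) I U) \<and>
      real (card (hor (mball x r) I U)) / real (card (hor (mball x s) I U)) > 1 - \<epsilon>)"

text \<open>Index sets are taken inside the fixed type \<open>'a set \<times> nat\<close>, because a formula cannot quantify
  over types. Lemma \<open>amenability_cover_reindex\<close> below shows that this is no restriction: an
  amenability cover with indices of any type yields one with indices of this type.\<close>

definition coarsely_amenable :: bool
  where "coarsely_amenable \<longleftrightarrow>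
    (\<forall>r s \<epsilon>. 0 < r \<longrightarrow> r < s \<longrightarrow> 0 < \<epsilon> \<longrightarrow>
      (\<exists>(I :: ('a set \<times> nat) set) U. amenability_cover r s \<epsilon> I U))"

lemma amenability_cover_reindex:
  fixes I :: "'i set"
  assumes "0 < s" and "amenability_cover r s \<epsilon> I U"
  shows "\<exists>(J :: ('a set \<times> nat) set) V. amenability_cover r s \<epsilon> J V"
proof -
  define K where "K = {i \<in> I. U i \<noteq> {}}"
  define F where "F = (\<lambda>A. {i \<in> K. U i = A})"
  define f where "f = (\<lambda>i. (U i, to_nat_on (F (U i)) i))"
  have cov: "(\<Union>i\<in>I. U i) = M"
    and bd: "\<exists>R. \<forall>i\<in>I. \<forall>x\<in>U i. \<forall>y\<in>U i. d x y < R"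
    and fin: "\<And>x. x \<in> M \<Longrightarrow> finite (hor (mball x s) I U)"
    and ratio: "\<And>x. x \<in> M \<Longrightarrow>
      real (card (hor (mball x r) I U)) / real (card (hor (mball x s) I U)) > 1 - \<epsilon>"
    using assms(2)
    unfolding amenability_cover_def indexed_cover_def uniformly_bounded_def by auto
  have finF: "finite (F (U i))" if iK: "i \<in> K" for i
  proof -
    obtain x where x: "x \<in> U i" "x \<in> M" using iK cov unfolding K_def by blast
    have "F (U i) \<subseteq> hor (mball x s) I U"
      using x \<open>0 < s\<close> by (auto simp: F_def K_def hor_def)
    then show ?thesis using fin[OF x(2)] finite_subset by blast
  qed
  have inj: "inj_on f K"
  proof (rule inj_onI)
    fix i j assume ij: "i \<in> K" "j \<in> K" "f i = f j"
    then have eq: "U i = U j" "to_nat_on (F (U i)) i = to_nat_on (F (U i)) j"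
      by (auto simp: f_def)
    have "i \<in> F (U i)" "j \<in> F (U i)" using ij eq by (auto simp: F_def)
    then show "i = j"
      using eq(2) finF[OF ij(1)] by (simp add: countable_finite)
  qed
  have hor_eq: "hor A (f ` K) fst = f ` hor A I U" for A
  proof -
    have "hor A (f ` K) fst = f ` {i \<in> K. A \<inter> U i \<noteq> {}}"
    proof -
      have "fst (f i) = U i" for i by (simp add: f_def)
      then show ?thesis unfolding hor_def by blast
    qed
    also have "{i \<in> K. A \<inter> U i \<noteq> {}} = hor A I U" by (auto simp: hor_def K_def)
    finally show ?thesis .
  qed
  have card_eq: "card (hor A (f ` K) fst) = card (hor A I U)" for A
    unfolding hor_eq
    by (rule card_image, rule inj_on_subset[OF inj]) (auto simp: hor_def K_def)
  have "amenability_cover r s \<epsilon> (f ` K) fst"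
    unfolding amenability_cover_def indexed_cover_def uniformly_bounded_def card_eq
  proof (intro conjI ballI)
    show "(\<Union>i\<in>f ` K. fst i) = M" using cov by (auto simp: f_def K_def)
    show "\<exists>R. \<forall>i\<in>f ` K. \<forall>x\<in>fst i. \<forall>y\<in>fst i. d x y < R"
      using bd by (auto simp: f_def K_def)
  qed (use fin ratio in \<open>auto simp: hor_eq\<close>)
  then show ?thesis by blast
qed

end


section \<open>Coarse disjoint unions\<close>

text \<open>Diameter of a set \<open>S\<close> with respect to an explicitly given distance; the analogue of
  \<^const>\<open>diameter\<close>, which is tied to the type class of metric spaces.\<close>

definition diam :: "'a set \<Rightarrow> ('a \<Rightarrow> 'a \<Rightarrow> real) \<Rightarrow> real"
  where "diam S d = (if S = {} then 0 else SUP (x, y)\<in>S \<times> S. d x y)"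

text \<open>The disjoint union of the \<open>X i\<close>, \<open>i \<in> I\<close>, is \<^term>\<open>Sigma I X\<close>. The following distance is
  a metric on it unless two of the spaces are singletons, see \<open>Metric_space_coarse_union\<close>.\<close>

definition coarse_union_dist ::
    "('i \<Rightarrow> 'a set) \<Rightarrow> ('i \<Rightarrow> 'a \<Rightarrow> 'a \<Rightarrow> real) \<Rightarrow> 'i \<times> 'a \<Rightarrow> 'i \<times> 'a \<Rightarrow> real"
  where "coarse_union_dist X d p q =
    (if fst p = fst q then d (fst p) (snd p) (snd q)
     else diam (X (fst p)) (d (fst p)) + diam (X (fst q)) (d (fst q)))"

lemma diam_upper:
  assumes "bdd_above ((\<lambda>(x, y). d x y) ` (S \<times> S))" "x \<in> S" "y \<in> S"
  shows "d x y \<le> diam S d"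
proof -
  have "(\<lambda>(x, y). d x y) (x, y) \<le> (SUP (x, y)\<in>S \<times> S. d x y)"
    by (rule cSUP_upper) (use assms in auto)
  then show ?thesis using assms by (auto simp: diam_def)
qed

lemma Metric_space_coarse_union:
  assumes met: "\<And>i. Metric_space (X i) (d i)"
    and bdd: "\<And>i. bdd_above ((\<lambda>(x, y). d i x y) ` (X i \<times> X i))"
    and nontriv: "\<And>i j. i \<in> I \<Longrightarrow> j \<in> I \<Longrightarrow> i \<noteq> j \<Longrightarrow>
      (\<exists>x\<in>X i. \<exists>y\<in>X i. x \<noteq> y) \<or> (\<exists>x\<in>X j. \<exists>y\<in>X j. x \<noteq> y)"
  shows "Metric_space (Sigma I X) (coarse_union_dist X d)"
proof -
  have up: "d i x y \<le> diam (X i) (d i)" if "x \<in> X i" "y \<in> X i" for i x y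
    using diam_upper[OF bdd] that by auto
  have d0: "0 \<le> d i x y" for i x y using met[of i] by (simp add: Metric_space.nonneg)
  have nn: "0 \<le> diam (X i) (d i)" for i
  proof (cases "X i = {}")
    case False
    then obtain x where "x \<in> X i" by blast
    then show ?thesis using up[of x i x] d0[of i x x] by linarith
  qed (simp add: diam_def)
  have pos: "0 < diam (X i) (d i) + diam (X j) (d j)" if ij: "i \<in> I" "j \<in> I" "i \<noteq> j" for i j
  proof -
    have "0 < diam (X k) (d k)" if "\<exists>x\<in>X k. \<exists>y\<in>X k. x \<noteq> y" for k
      using that up[of _ k] Metric_space.mdist_pos_less[OF met[of k]]
      by (meson less_le_trans)
    then show ?thesis using nontriv[OF ij] nn[of i] nn[of j] by fastforce
  qed
  show ?thesis
  proof
    fix p q :: "'a \<times> 'b"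
    show "0 \<le> coarse_union_dist X d p q"
      using d0 nn by (simp add: coarse_union_dist_def)
    show "coarse_union_dist X d p q = coarse_union_dist X d q p"
      using Metric_space.commute[OF met] by (auto simp: coarse_union_dist_def)
  next
    fix p q assume A: "p \<in> Sigma I X" "q \<in> Sigma I X"
    obtain i x j y where E: "p = (i, x)" "q = (j, y)" by (metis surj_pair)
    show "(coarse_union_dist X d p q = 0) = (p = q)"
    proof (cases "i = j")
      case True
      then show ?thesis
        using Metric_space.zero[OF met[of i], of x y] A E by (simp add: coarse_union_dist_def)
    next
      case False
      then show ?thesis
        using pos[of i j] A E by (simp add: coarse_union_dist_def)
    qed
  next
    fix p q r assume A: "p \<in> Sigma I X" "q \<in> Sigma I X" "r \<in> Sigma I X"
    obtain i x j y k z where E: "p = (i, x)" "q = (j, y)" "r = (k, z)"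
      by (metis surj_pair)
    have xs: "x \<in> X i" "y \<in> X j" "z \<in> X k" using A E by auto
    show "coarse_union_dist X d p r \<le> coarse_union_dist X d p q + coarse_union_dist X d q r"
      using Metric_space.triangle[OF met[of i], of x y z] up[of x i z] xs
        nn[of i] nn[of j] nn[of k] d0[of i x y] d0[of j y z]
      unfolding E coarse_union_dist_def by (auto split: if_splits)
  qed
qed


section \<open>Powers with the \<open>l\<^sub>1\<close> metric\<close>

text \<open>The coordinates of an \<open>n\<close>-tuple are indexed by \<open>{1..n}\<close>.\<close>

definition l1_dist :: "nat \<Rightarrow> ('a \<Rightarrow> 'a \<Rightarrow> real) \<Rightarrow> (nat \<Rightarrow> 'a) \<Rightarrow> (nat \<Rightarrow> 'a) \<Rightarrow> real"
  where "l1_dist n d x y = (\<Sum>i=1..n. d (x i) (y i))"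

definition group_power :: "('a, 'b) monoid_scheme \<Rightarrow> nat \<Rightarrow> (nat \<Rightarrow> 'a) monoid"
  where "group_power G n = product_group {1..n} (\<lambda>_. G)"

end

theory Submission
  imports Defs
begin

text \<open>Both spaces contain discrete cubes of every dimension \<open>n\<close> (vertices are the subsets of
  \<open>{1..n}\<close>) whose edges have bounded length and in which bounded distance means bounded Hamming
  distance, uniformly in \<open>n\<close>. Attach to a vertex \<open>T\<close> the set \<open>A T\<close> of members of an amenability cover
  meeting a fixed ball around \<open>T\<close>. Along an edge the sets \<open>A T\<close> and \<open>A T'\<close> differ by at most half
  of their size. Summing over all edges, some index \<open>i\<close> has a vertex set \<open>{T. i \<in> A T}\<close> at most
  half of whose directed edges leave it. But this vertex set has Hamming diameter at most some
  \<open>D\<close> independent of \<open>n\<close>, and of the \<open>n\<close> edges at a vertex at most \<open>2 D\<close> on average stay inside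
  such a set, which is absurd when \<open>n > 4 D\<close>.\<close>

section \<open>Edge boundaries in the discrete cube\<close>

definition flip :: "'a set \<Rightarrow> 'a \<Rightarrow> 'a set"
  where "flip T j = sym_diff T {j}"

lemma flip_flip [simp]: "flip (flip T j) j = T"
  by (auto simp: flip_def)

lemma flip_subset: "T \<subseteq> J \<Longrightarrow> j \<in> J \<Longrightarrow> flip T j \<subseteq> J"
  by (auto simp: flip_def)

lemma sym_diff_flip: "sym_diff (flip T j) T = {j}"
  by (auto simp: flip_def)

lemma sum_flip:
  assumes "j \<in> J"
  shows "(\<Sum>T\<in>Pow J. f (flip T j)) = (\<Sum>T\<in>Pow J. f T)"
  by (rule sum.reindex_bij_witness[of _ "\<lambda>T. flip T j" "\<lambda>T. flip T j"])
    (use assms in \<open>auto dest: flip_subset[OF _ assms, THEN subsetD]\<close>)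

text \<open>Relative to a base point \<open>Z\<close>, the involution reversing an edge exchanges the inner edges
  leading away from \<open>Z\<close> with those leading towards \<open>Z\<close>, and at most \<open>D\<close> edges at each vertex lead
  towards \<open>Z\<close>.\<close>

lemma cube_edge_boundary:
  assumes J: "finite J" and S: "S \<subseteq> Pow J"
    and diam: "\<And>T Z. T \<in> S \<Longrightarrow> Z \<in> S \<Longrightarrow> card (sym_diff T Z) \<le> D"
  shows "card J * card S \<le> card {(T, j). T \<in> S \<and> j \<in> J \<and> flip T j \<notin> S} + 2 * D * card S"
proof (cases "S = {}")
  case False
  then obtain Z where Z: "Z \<in> S" by blast
  have fS: "finite S" using S J by (meson finite_Pow_iff finite_subset)
  \<comment> \<open>A pair \<open>(T, j)\<close> stands for the directed edge from \<open>T\<close>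
    to \<open>flip T j\<close>.\<close>
  define Out where "Out = {(T, j). T \<in> S \<and> j \<in> J \<and> flip T j \<notin> S}"
  define In where "In = {(T, j). T \<in> S \<and> j \<in> J \<and> flip T j \<in> S}"
  \<comment> \<open>Flipping \<open>j\<close> brings \<open>T\<close> closer to \<open>Z\<close> in
    Hamming distance exactly when \<open>j\<close> lies in \<open>sym_diff T Z\<close>.\<close>
  define Down where "Down = {(T, j) \<in> In. j \<in> sym_diff T Z}"
  define Up where "Up = {(T, j) \<in> In. j \<notin> sym_diff T Z}"
  have fin: "finite Out" "finite In" "finite Down" "finite Up"
    by (rule finite_subset[of _ "S \<times> J"]; use fS J in \<open>auto simp: Out_def In_def Down_def Up_def\<close>)+
  have "card Down \<le> card (SIGMA T:S. sym_diff T Z)"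
    using fS S J Z
    by (intro card_mono finite_SigmaI) (auto simp: Down_def In_def intro: finite_subset)
  also have "\<dots> = (\<Sum>T\<in>S. card (sym_diff T Z))"
    using fS S J Z by (intro card_SigmaI) (auto intro: finite_subset)
  also have "\<dots> \<le> D * card S"
    using sum_bounded_above[of S "\<lambda>T. card (sym_diff T Z)" D] diam Z by (simp add: mult.commute)
  finally have down: "card Down \<le> D * card S" .
  have "card Up \<le> card Down"
  proof (rule card_inj_on_le)
    show "inj_on (\<lambda>(T, j). (flip T j, j)) Up"
      by (rule inj_on_inverseI[where g = "\<lambda>(T, j). (flip T j, j)"]) auto
    show "(\<lambda>(T, j). (flip T j, j)) ` Up \<subseteq> Down"
      by (auto simp: Up_def Down_def In_def) (auto simp: flip_def)
  qed (rule fin)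
  moreover have "In = Up \<union> Down" "Up \<inter> Down = {}"
    by (auto simp: Up_def Down_def)
  then have "card In = card Up + card Down"
    using fin by (simp add: card_Un_disjoint)
  moreover have "card J * card S = card Out + card In"
  proof -
    have "S \<times> J = Out \<union> In" "Out \<inter> In = {}"
      by (auto simp: Out_def In_def)
    then show ?thesis
      using fin by (metis card_Un_disjoint card_cartesian_product mult.commute)
  qed
  ultimately show ?thesis using down unfolding Out_def by linarith
qed simp

text \<open>Double counting: instead of singling out one index, the edge bound for the sets
  \<open>S i\<close> is summed over all \<open>i\<close>. With \<open>N\<close> the number of pairs
  \<open>(T, i)\<close> such that \<open>i \<in> A T\<close>, the directed edges leaving the
  \<open>S i\<close> number at least \<open>(card J - 2 * D) * N\<close> in total, while
  \<open>half\<close> allows at most half of \<open>card J * N\<close>.\<close>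

lemma cube_dimension_bound:
  fixes A :: "'j set \<Rightarrow> 'i set"
  assumes J: "finite J"
    and fin: "\<And>T. T \<subseteq> J \<Longrightarrow> finite (A T)"
    and ne: "\<And>T. T \<subseteq> J \<Longrightarrow> A T \<noteq> {}"
    and half: "\<And>T j. T \<subseteq> J \<Longrightarrow> j \<in> J \<Longrightarrow> 2 * card (A (flip T j) - A T) \<le> card (A T)"
    and diam: "\<And>T Z. T \<subseteq> J \<Longrightarrow> Z \<subseteq> J \<Longrightarrow> A T \<inter> A Z \<noteq> {} \<Longrightarrow> card (sym_diff T Z) \<le> D"
  shows "card J \<le> 4 * D"
proof -
  define I where "I = (\<Union>T\<in>Pow J. A T)"
  have fI: "finite I" using J fin by (auto simp: I_def)
  define S where "S i = {T \<in> Pow J. i \<in> A T}" for i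
  have fS: "finite (S i)" for i using J by (simp add: S_def)
  define N where "N = (\<Sum>T\<in>Pow J. card (A T))"
  have "0 < N"
    unfolding N_def using J fin ne by (intro sum_pos) (auto simp: card_gt_0_iff)
  have card_I: "card B = (\<Sum>i\<in>I. of_bool (i \<in> B))" if "B \<subseteq> I" for B
    using that fI by (simp add: sum.If_cases Int_absorb1 of_bool_def)
  have N_eq: "N = (\<Sum>i\<in>I. card (S i))"
  proof -
    have "N = (\<Sum>T\<in>Pow J. \<Sum>i\<in>I. of_bool (i \<in> A T))"
      unfolding N_def by (intro sum.cong refl card_I) (auto simp: I_def)
    also have "\<dots> = (\<Sum>i\<in>I. \<Sum>T\<in>Pow J. of_bool (i \<in> A T))" by (rule sum.swap)
    also have "\<dots> = (\<Sum>i\<in>I. card (S i))"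
      using J by (intro sum.cong refl) (simp add: S_def of_bool_def sum.If_cases Int_def)
    finally show ?thesis .
  qed
  let ?out = "\<lambda>i. {(T, j). T \<in> S i \<and> j \<in> J \<and> flip T j \<notin> S i}"
  \<comment> \<open>An edge leaves \<open>S i\<close> exactly when \<open>i\<close> is lost along
    it, so both sides count pairs of an edge and an index lost along it.\<close>
  have out_eq: "(\<Sum>i\<in>I. card (?out i)) = (\<Sum>(T, j)\<in>Pow J \<times> J. card (A T - A (flip T j)))"
  proof -
    have "card (?out i) = (\<Sum>p\<in>Pow J \<times> J. of_bool (i \<in> A (fst p) - A (flip (fst p) (snd p))))"
      for i
    proof -
      have "?out i = {p \<in> Pow J \<times> J. i \<in> A (fst p) - A (flip (fst p) (snd p))}"
        using flip_subset[of _ J] unfolding S_def by (auto split: prod.splits)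
      then show ?thesis
        using J by (simp add: of_bool_def sum.If_cases Int_def)
    qed
    then have "(\<Sum>i\<in>I. card (?out i)) =
        (\<Sum>i\<in>I. \<Sum>p\<in>Pow J \<times> J. of_bool (i \<in> A (fst p) - A (flip (fst p) (snd p))))"
      by simp
    also have "\<dots> = (\<Sum>p\<in>Pow J \<times> J. \<Sum>i\<in>I. of_bool (i \<in> A (fst p) - A (flip (fst p) (snd p))))"
      by (rule sum.swap)
    also have "\<dots> = (\<Sum>p\<in>Pow J \<times> J. card (A (fst p) - A (flip (fst p) (snd p))))"
      by (intro sum.cong refl card_I[symmetric]) (auto simp: I_def)
    finally show ?thesis by (simp add: case_prod_unfold)
  qed
  \<comment> \<open>An index lost along an edge is gained along the reversed edge, so
    \<open>half\<close> is applied at \<open>flip T j\<close>; \<open>sum_flip\<close> then moves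
    the sum back to \<open>T\<close>.\<close>
  have "2 * (\<Sum>(T, j)\<in>Pow J \<times> J. card (A T - A (flip T j)))
      \<le> (\<Sum>(T, j)\<in>Pow J \<times> J. card (A (flip T j)))"
    unfolding sum_distrib_left
  proof (intro sum_mono, clarify)
    fix T j assume "T \<subseteq> J" "j \<in> J"
    then show "2 * card (A T - A (flip T j)) \<le> card (A (flip T j))"
      using half[of "flip T j" j] flip_subset[of T J j] by simp
  qed
  also have "\<dots> = (\<Sum>j\<in>J. \<Sum>T\<in>Pow J. card (A (flip T j)))"
    unfolding sum.cartesian_product[symmetric] by (rule sum.swap)
  also have "\<dots> = card J * N"
    by (simp add: N_def sum_flip[where f = "\<lambda>T. card (A T)"])
  finally have upper: "2 * (\<Sum>i\<in>I. card (?out i)) \<le> card J * N" unfolding out_eq .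
  have "card J * N = (\<Sum>i\<in>I. card J * card (S i))"
    by (simp add: N_eq sum_distrib_left)
  also have "\<dots> \<le> (\<Sum>i\<in>I. card (?out i) + 2 * D * card (S i))"
  proof (rule sum_mono)
    fix i
    \<comment> \<open>Any two vertices of \<open>S i\<close> share the index \<open>i\<close>, so
      \<open>diam\<close> bounds their Hamming distance.\<close>
    show "card J * card (S i) \<le> card (?out i) + 2 * D * card (S i)"
      using J by (rule cube_edge_boundary) (auto simp: S_def intro!: diam)
  qed
  also have "\<dots> = (\<Sum>i\<in>I. card (?out i)) + 2 * D * N"
    by (simp add: N_eq sum.distrib sum_distrib_left)
  finally have "card J * N \<le> (4 * D) * N" using upper by linarith
  then show ?thesis using \<open>0 < N\<close> by simp
qed

section \<open>Cubes of unbounded dimension as an obstruction to coarse amenability\<close>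

context Metric_space
begin

text \<open>The common criterion for both spaces. \<open>K\<close> and \<open>D\<close> must not
  depend on \<open>n\<close>: the cover and its bound \<open>R\<close> are obtained first, and only
  then is the dimension chosen large.\<close>

lemma not_coarsely_amenable_cubes:
  fixes c :: "nat \<Rightarrow> nat set \<Rightarrow> 'a" and D :: "real \<Rightarrow> nat"
  assumes cM: "\<And>n T. 0 < n \<Longrightarrow> T \<subseteq> {1..n} \<Longrightarrow> c n T \<in> M"
    and edge: "\<And>n T j. 0 < n \<Longrightarrow> T \<subseteq> {1..n} \<Longrightarrow> j \<in> {1..n} \<Longrightarrow> d (c n (flip T j)) (c n T) \<le> K"
    and proper: "\<And>n T Z R. 0 < n \<Longrightarrow> T \<subseteq> {1..n} \<Longrightarrow> Z \<subseteq> {1..n} \<Longrightarrow>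
      d (c n T) (c n Z) < R \<Longrightarrow> card (sym_diff T Z) \<le> D R"
  shows "\<not> coarsely_amenable"
proof
  assume "coarsely_amenable"
  \<comment> \<open>The unit ball about an adjacent vertex lies in the \<open>s\<close>-ball about
    the vertex once \<open>s\<close> is at least \<open>1 + \<bar>K\<bar>\<close>; the extra 1
    ensures \<open>1 < s\<close> even for \<open>K = 0\<close>.\<close>
  define s where "s = 2 + \<bar>K\<bar>"
  \<comment> \<open>With \<open>1 / 3\<close>, more than two thirds of the indices for the large
    ball belong to the small one; fewer than one third remain, which is less than half as
    many.\<close>
  have "0 < (1::real)" "1 < s" "0 < 1 / (3::real)" by (auto simp: s_def)
  with \<open>coarsely_amenable\<close> obtain I :: "('a set \<times> nat) set" and U
    where "amenability_cover 1 s (1 / 3) I U"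
    unfolding coarsely_amenable_def by blast
  then obtain R where R: "\<And>i x y. i \<in> I \<Longrightarrow> x \<in> U i \<Longrightarrow> y \<in> U i \<Longrightarrow> d x y < R"
    and fin: "\<And>x. x \<in> M \<Longrightarrow> finite (hor (mball x s) I U)"
    and ratio: "\<And>x. x \<in> M \<Longrightarrow>
      real (card (hor (mball x 1) I U)) / real (card (hor (mball x s) I U)) > 1 - 1 / 3"
    unfolding amenability_cover_def indexed_cover_def uniformly_bounded_def by blast
  \<comment> \<open>Vertices whose unit balls meet a common member are less than
    \<open>R + 2\<close> apart; \<open>n\<close> is one more than the resulting bound on the
    dimension.\<close>
  define n where "n = Suc (4 * D (R + 2))"
  define A where "A T = hor (mball (c n T) 1) I U" for T
  have n: "0 < n" by (simp add: n_def)
  have horI: "hor (mball y 1) I U \<subseteq> hor (mball x s) I U" if "x \<in> M" "y \<in> M" "d y x \<le> \<bar>K\<bar>" for x y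
  proof -
    have "mball y 1 \<subseteq> mball x s"
      using that triangle[of x y] commute[of x y] by (fastforce simp: s_def)
    then show ?thesis by (auto simp: hor_def)
  qed
  have fin1: "finite (hor (mball x 1) I U)" if "x \<in> M" for x
    by (rule finite_subset[OF horI[OF that that] fin[OF that]]) (use that in simp)
  have large: "3 * card (hor (mball x 1) I U) > 2 * card (hor (mball x s) I U)" if "x \<in> M" for x
  proof -
    \<comment> \<open>Division by zero yields 0, so a zero denominator would contradict the lower
      bound 2/3.\<close>
    have "real (card (hor (mball x s) I U)) \<noteq> 0" using ratio[OF that] by (intro notI) simp
    then have "real (card (hor (mball x s) I U)) > 0" by simp
    then show ?thesis using ratio[OF that] by (simp add: field_simps)
  qed
  have "card {1..n} \<le> 4 * D (R + 2)"
  proof (rule cube_dimension_bound[where A = A])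
    fix T assume T: "T \<subseteq> {1..n}"
    show "finite (A T)" using fin1[OF cM[OF n T]] by (simp add: A_def)
    show "A T \<noteq> {}" using large[OF cM[OF n T]] by (auto simp: A_def)
    fix j assume j: "j \<in> {1..n}"
    let ?x = "c n T" and ?y = "c n (flip T j)"
    have xy: "?x \<in> M" "?y \<in> M" by (rule cM[OF n T], rule cM[OF n flip_subset[OF T j]])
    have "d ?y ?x \<le> \<bar>K\<bar>" using edge[OF n T j] by linarith
    \<comment> \<open>Members gained along the edge meet the large ball about \<open>?x\<close> but
      not the small one.\<close>
    then have "A (flip T j) - A T \<subseteq> hor (mball ?x s) I U - hor (mball ?x 1) I U"
      using horI[OF xy] by (auto simp: A_def)
    then have "card (A (flip T j) - A T) \<le> card (hor (mball ?x s) I U - hor (mball ?x 1) I U)"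
      using fin[OF xy(1)] by (intro card_mono) auto
    also have "\<dots> = card (hor (mball ?x s) I U) - card (hor (mball ?x 1) I U)"
      using fin1 xy horI[of ?x ?x] by (intro card_Diff_subset) auto
    finally show "2 * card (A (flip T j) - A T) \<le> card (A T)"
      using large[OF xy(1)] by (simp add: A_def)
  next
    fix T Z assume T: "T \<subseteq> {1..n}" and Z: "Z \<subseteq> {1..n}" and "A T \<inter> A Z \<noteq> {}"
    then obtain i where "i \<in> A T" "i \<in> A Z" by blast
    then have i: "i \<in> I" and T': "mball (c n T) 1 \<inter> U i \<noteq> {}" and Z': "mball (c n Z) 1 \<inter> U i \<noteq> {}"
      unfolding A_def hor_def by blast+
    obtain p where p: "p \<in> U i" "p \<in> mball (c n T) 1" using T' by blast
    obtain q where q: "q \<in> U i" "q \<in> mball (c n Z) 1" using Z' by blast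
    have "d (c n T) (c n Z) < R + 2"
    proof -
      have M: "c n T \<in> M" "p \<in> M" "q \<in> M" "c n Z \<in> M"
        and "d (c n T) p < 1" "d (c n Z) q < 1"
        using p(2) q(2) unfolding in_mball by blast+
      moreover have "d (c n T) (c n Z) \<le> d (c n T) p + (d p q + d (c n Z) q)"
        using triangle[OF M(1,2,4)] triangle'[OF M(2,3,4)] by linarith
      ultimately show ?thesis using R[OF i p(1) q(1)] by linarith
    qed
    then show "card (sym_diff T Z) \<le> D (R + 2)" by (rule proper[OF n T Z])
  qed simp
  then show False by (simp add: n_def)
qed

end

section \<open>Powers of a finite metric space\<close>

lemma Metric_space_l1_dist:
  assumes "Metric_space M d"
  shows "Metric_space (PiE {1..n} (\<lambda>_. M)) (l1_dist n d)"
proof -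
  interpret Metric_space M d by fact
  show ?thesis
  proof
    show "0 \<le> l1_dist n d x y" for x y by (simp add: l1_dist_def sum_nonneg)
    show "l1_dist n d x y = l1_dist n d y x" for x y by (simp add: l1_dist_def commute)
    show "(l1_dist n d x y = 0) = (x = y)"
      if "x \<in> PiE {1..n} (\<lambda>_. M)" "y \<in> PiE {1..n} (\<lambda>_. M)" for x y
    proof -
      have "(l1_dist n d x y = 0) = (\<forall>i\<in>{1..n}. x i = y i)"
        unfolding l1_dist_def using PiE_mem[OF that(1)] PiE_mem[OF that(2)]
        by (subst sum_nonneg_eq_0_iff) auto
      then show ?thesis using PiE_ext[OF that] by auto
    qed
    show "l1_dist n d x z \<le> l1_dist n d x y + l1_dist n d y z"
      if "x \<in> PiE {1..n} (\<lambda>_. M)" "y \<in> PiE {1..n} (\<lambda>_. M)" "z \<in> PiE {1..n} (\<lambda>_. M)" for x y z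
      unfolding l1_dist_def sum.distrib[symmetric]
      using that by (intro sum_mono triangle) (auto simp: PiE_mem)
  qed
qed

text \<open>Each coordinate on which \<open>T\<close> and \<open>Z\<close> disagree contributes
  \<open>d a b\<close>, every other one 0. Tuples with entries \<open>a\<close> and \<open>b\<close>
  thus form a Hamming cube scaled by \<open>d a b\<close>.\<close>

lemma l1_dist_two_point:
  fixes d :: "'a \<Rightarrow> 'a \<Rightarrow> real"
  assumes "Metric_space M d" "a \<in> M" "b \<in> M" "T \<subseteq> {1..n}" "Z \<subseteq> {1..n}"
  shows "l1_dist n d (\<lambda>i\<in>{1..n}. if i \<in> T then a else b) (\<lambda>i\<in>{1..n}. if i \<in> Z then a else b)
    = card (sym_diff T Z) * d a b"
proof -
  interpret Metric_space M d by fact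
  have "l1_dist n d (\<lambda>i\<in>{1..n}. if i \<in> T then a else b) (\<lambda>i\<in>{1..n}. if i \<in> Z then a else b)
      = (\<Sum>i\<in>{1..n}. if i \<in> sym_diff T Z then d a b else 0)"
    using assms by (auto simp: l1_dist_def commute[of b a] intro!: sum.cong)
  also have "\<dots> = (\<Sum>i\<in>{1..n} \<inter> sym_diff T Z. d a b)"
    by (rule sum.inter_restrict[symmetric]) simp
  also have "{1..n} \<inter> sym_diff T Z = sym_diff T Z" using assms by auto
  also have "(\<Sum>i\<in>sym_diff T Z. d a b) = card (sym_diff T Z) * d a b" by simp
  finally show ?thesis .
qed

lemma powers_not_coarsely_amenable:
  fixes M :: "'a set"
  assumes "finite M" "Metric_space M d" "a \<in> M" "b \<in> M" "a \<noteq> b"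
  shows "\<not> Metric_space.coarsely_amenable (SIGMA n:{1..}. PiE {1..n} (\<lambda>_. M))
    (coarse_union_dist (\<lambda>n. PiE {1..n} (\<lambda>_. M)) (\<lambda>n. l1_dist n d))"
proof -
  let ?P = "\<lambda>n::nat. PiE {1..n} (\<lambda>_. M)"
  let ?v = "\<lambda>n T. \<lambda>i\<in>{1..n::nat}. if i \<in> T then a else b"
  have v: "?v n T \<in> ?P n" for n T using assms by auto
  have dist: "coarse_union_dist ?P (\<lambda>n. l1_dist n d) (n, ?v n T) (n, ?v n Z)
      = card (sym_diff T Z) * d a b" if "T \<subseteq> {1..n}" "Z \<subseteq> {1..n}" for n T Z
    using l1_dist_two_point[OF assms(2-4) that] by (simp add: coarse_union_dist_def)
  have pos: "0 < d a b" using Metric_space.mdist_pos_less[OF assms(2) assms(5,3,4)] .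
  have "Metric_space (Sigma {1..} ?P) (coarse_union_dist ?P (\<lambda>n. l1_dist n d))"
  proof (rule Metric_space_coarse_union)
    show "Metric_space (?P n) (l1_dist n d)" for n by (rule Metric_space_l1_dist[OF assms(2)])
    show "bdd_above ((\<lambda>(x, y). l1_dist n d x y) ` (?P n \<times> ?P n))" for n
      using assms(1) by (intro bdd_above_finite finite_imageI finite_cartesian_product finite_PiE) auto
    fix n m :: nat assume "n \<in> {1..}"
    \<comment> \<open>Coordinate 1 exists because \<open>n\<close> is at least 1, so no power in the
      union is a singleton and the union distance is a metric.\<close>
    then have "?v n {1} 1 \<noteq> ?v n {} 1" using assms(5) by simp
    then have "?v n {1} \<noteq> ?v n {}" by metis
    then show "(\<exists>x\<in>?P n. \<exists>y\<in>?P n. x \<noteq> y) \<or> (\<exists>x\<in>?P m. \<exists>y\<in>?P m. x \<noteq> y)"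
      by (intro disjI1 bexI[OF _ v[of "{1}" n]] bexI[OF _ v[of "{}" n]])
  qed
  then interpret X: Metric_space "Sigma {1..} ?P" "coarse_union_dist ?P (\<lambda>n. l1_dist n d)" .
  show ?thesis
  \<comment> \<open>Edges have length \<open>d a b\<close>, and distance below \<open>R\<close>
    forces Hamming distance below \<open>R / d a b\<close>, whatever \<open>n\<close> is.\<close>
  proof (rule X.not_coarsely_amenable_cubes
      [where c = "\<lambda>n T. (n, ?v n T)" and K = "d a b" and D = "\<lambda>R. nat \<lceil>R / d a b\<rceil>"])
    show "(n, ?v n T) \<in> Sigma {1..} ?P" if "0 < n" for n T using v that by simp
    show "coarse_union_dist ?P (\<lambda>n. l1_dist n d) (n, ?v n (flip T j)) (n, ?v n T) \<le> d a b"
      if "T \<subseteq> {1..n}" "j \<in> {1..n}" for n T j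
      unfolding dist[OF flip_subset[OF that] that(1)] sym_diff_flip by simp
    show "card (sym_diff T Z) \<le> nat \<lceil>R / d a b\<rceil>"
      if "T \<subseteq> {1..n}" "Z \<subseteq> {1..n}"
        "coarse_union_dist ?P (\<lambda>n. l1_dist n d) (n, ?v n T) (n, ?v n Z) < R" for n T Z R
    proof -
      have "real (card (sym_diff T Z)) < R / d a b"
        using that(3) pos unfolding dist[OF that(1,2)] by (simp add: pos_less_divide_eq)
      then show ?thesis by linarith
    qed
  qed
qed

section \<open>Infinite-dimensional inner product spaces\<close>

text \<open>Gram-Schmidt: some \<open>v\<close> lies outside the span of the finite set
  \<open>B\<close>; subtracting its projection and normalising gives one more vector.\<close>

lemma exists_orthonormal:
  assumes inf: "\<not> (\<exists>B :: 'h::real_inner set. finite B \<and> span B = UNIV)"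
  shows "\<exists>B :: 'h set. finite B \<and> card B = n \<and> pairwise orthogonal B \<and> (\<forall>b\<in>B. norm b = 1)"
proof (induction n)
  case 0
  show ?case by (rule exI[of _ "{}"]) simp
next
  case (Suc n)
  then obtain B :: "'h set" where B: "finite B" "card B = n" "pairwise orthogonal B"
    "\<And>b. b \<in> B \<Longrightarrow> norm b = 1" by blast
  obtain v where v: "v \<notin> span B" using inf B(1) by blast
  define w where "w = v - (\<Sum>b\<in>B. (v \<bullet> b) *\<^sub>R b)"
  have "(\<Sum>b\<in>B. (v \<bullet> b) *\<^sub>R b) \<in> span B"
    by (intro span_sum span_scale span_base)
  then have "w \<noteq> 0" using v by (auto simp: w_def)
  have orth: "w \<bullet> b = 0" if b: "b \<in> B" for b
  proof -
    have "(\<Sum>b'\<in>B. (v \<bullet> b') *\<^sub>R b') \<bullet> b = (\<Sum>b'\<in>B. if b' = b then v \<bullet> b else 0)"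
      unfolding inner_sum_left
      using b B(3) B(4)[OF b]
      by (intro sum.cong) (auto simp: pairwise_def orthogonal_def norm_eq_1)
    also have "\<dots> = v \<bullet> b" using b B(1) by simp
    finally show ?thesis by (simp add: w_def inner_diff_left)
  qed
  let ?u = "w /\<^sub>R norm w"
  have u: "norm ?u = 1" "\<And>b. b \<in> B \<Longrightarrow> orthogonal ?u b"
    using \<open>w \<noteq> 0\<close> orth by (auto simp: orthogonal_def)
  \<comment> \<open>A member of \<open>B\<close> would be orthogonal to itself, hence zero; so the
    cardinality really grows.\<close>
  moreover have "?u \<notin> B" using u by (metis norm_zero orthogonal_self zero_neq_one)
  ultimately show ?case
    using B
    by (intro exI[of _ "insert ?u B"]) (auto simp: pairwise_insert orthogonal_commute)
qed

text \<open>By Pythagoras, subset sums of an orthonormal family form a cube carrying the square root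
  of the Hamming distance.\<close>

lemma norm_sum_orthonormal_diff:
  fixes e :: "'i \<Rightarrow> 'h::real_inner"
  assumes "finite T" "finite Z"
    and norm: "\<And>i. i \<in> T \<union> Z \<Longrightarrow> norm (e i) = 1"
    and orth: "\<And>i j. i \<in> T \<union> Z \<Longrightarrow> j \<in> T \<union> Z \<Longrightarrow> i \<noteq> j \<Longrightarrow> orthogonal (e i) (e j)"
  shows "norm ((\<Sum>i\<in>T. e i) - (\<Sum>i\<in>Z. e i)) = sqrt (card (sym_diff T Z))"
proof -
  \<comment> \<open>The coefficient is 1 or -1 on \<open>sym_diff T Z\<close> and 0 on the common
    indices.\<close>
  let ?f = "\<lambda>i. (of_bool (i \<in> T) - of_bool (i \<in> Z)) *\<^sub>R e i"
  have f: "(\<Sum>i\<in>T. e i) - (\<Sum>i\<in>Z. e i) = (\<Sum>i\<in>T \<union> Z. ?f i)"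
  proof -
    have "(\<Sum>i\<in>T. e i) = (\<Sum>i\<in>T \<union> Z. of_bool (i \<in> T) *\<^sub>R e i)"
      using assms by (intro sum.mono_neutral_cong_left) auto
    moreover have "(\<Sum>i\<in>Z. e i) = (\<Sum>i\<in>T \<union> Z. of_bool (i \<in> Z) *\<^sub>R e i)"
      using assms by (intro sum.mono_neutral_cong_left) auto
    ultimately show ?thesis by (simp add: sum_subtractf scaleR_left_diff_distrib)
  qed
  have "(norm (\<Sum>i\<in>T \<union> Z. ?f i))\<^sup>2 = (\<Sum>i\<in>T \<union> Z. (norm (?f i))\<^sup>2)"
    using assms(1,2) orth
    by (intro norm_sum_Pythagorean) (auto simp: pairwise_def orthogonal_clauses)
  also have "\<dots> = (\<Sum>i\<in>T \<union> Z. if i \<in> sym_diff T Z then 1 else 0)"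
    using norm by (intro sum.cong) auto
  also have "\<dots> = (\<Sum>i\<in>(T \<union> Z) \<inter> sym_diff T Z. 1)"
    using assms(1,2) by (intro sum.inter_restrict[symmetric]) auto
  also have "(T \<union> Z) \<inter> sym_diff T Z = sym_diff T Z" by auto
  finally show ?thesis
    unfolding f by (simp add: real_sqrt_unique)
qed

lemma infinite_dim_not_coarsely_amenable:
  assumes "\<not> (\<exists>B :: 'h::real_inner set. finite B \<and> span B = UNIV)"
  shows "\<not> Metric_space.coarsely_amenable (UNIV :: 'h set) dist"
proof -
  have "\<exists>e :: nat \<Rightarrow> 'h. (\<forall>i\<in>{1..n}. norm (e i) = 1) \<and>
    (\<forall>i\<in>{1..n}. \<forall>j\<in>{1..n}. i \<noteq> j \<longrightarrow> orthogonal (e i) (e j))" for n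
  proof -
    obtain B :: "'h set" where B: "finite B" "card B = n" "pairwise orthogonal B"
      "\<forall>b\<in>B. norm b = 1" using exists_orthonormal[OF assms] by blast
    then obtain e where e: "bij_betw e {1..n} B"
      using finite_same_card_bij[of "{1..n}" B] by auto
    show ?thesis
    proof (intro exI[of _ e] conjI ballI impI)
      fix i assume i: "i \<in> {1..n}"
      then show "norm (e i) = 1" using B(4) bij_betwE[OF e] by blast
      fix j assume j: "j \<in> {1..n}" and "i \<noteq> j"
      then have "e i \<noteq> e j" using i e by (meson bij_betw_imp_inj_on inj_onD)
      then show "orthogonal (e i) (e j)"
        using i j B(3) bij_betwE[OF e] by (meson pairwiseD)
    qed
  qed
  \<comment> \<open>Each dimension gets its own orthonormal family; the families for different
    \<open>n\<close> need not be related.\<close>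
  then have "\<exists>e :: nat \<Rightarrow> nat \<Rightarrow> 'h. \<forall>n. (\<forall>i\<in>{1..n}. norm (e n i) = 1) \<and>
    (\<forall>i\<in>{1..n}. \<forall>j\<in>{1..n}. i \<noteq> j \<longrightarrow> orthogonal (e n i) (e n j))"
    by (intro choice allI)
  then obtain e :: "nat \<Rightarrow> nat \<Rightarrow> 'h"
    where e: "\<And>n i. i \<in> {1..n} \<Longrightarrow> norm (e n i) = 1"
      "\<And>n i j. i \<in> {1..n} \<Longrightarrow> j \<in> {1..n} \<Longrightarrow> i \<noteq> j \<Longrightarrow> orthogonal (e n i) (e n j)"
    by blast
  have dist: "dist (\<Sum>i\<in>T. e n i) (\<Sum>i\<in>Z. e n i) = sqrt (card (sym_diff T Z))"
    if "T \<subseteq> {1..n}" "Z \<subseteq> {1..n}" for n T Z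
    unfolding dist_norm
    by (rule norm_sum_orthonormal_diff; (rule e)?)
      (use that in \<open>auto intro: finite_subset dest: subsetD\<close>)
  show ?thesis
  \<comment> \<open>Edges have length \<open>sqrt 1\<close>, and distance below \<open>R\<close>
    bounds the Hamming distance by the square of \<open>R\<close>, for every
    \<open>n\<close>.\<close>
  proof (rule Met_TC.not_coarsely_amenable_cubes
      [where c = "\<lambda>n T. \<Sum>i\<in>T. e n i" and K = 1 and D = "\<lambda>R. nat \<lceil>R\<^sup>2\<rceil>"])
    show "dist (\<Sum>i\<in>flip T j. e n i) (\<Sum>i\<in>T. e n i) \<le> 1"
      if "T \<subseteq> {1..n}" "j \<in> {1..n}" for n T j
      unfolding dist[OF flip_subset[OF that] that(1)] sym_diff_flip by simp
    show "card (sym_diff T Z) \<le> nat \<lceil>R\<^sup>2\<rceil>"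
      if "T \<subseteq> {1..n}" "Z \<subseteq> {1..n}" "dist (\<Sum>i\<in>T. e n i) (\<Sum>i\<in>Z. e n i) < R" for n T Z R
    proof -
      have "sqrt (card (sym_diff T Z)) < R" using that(3) unfolding dist[OF that(1,2)] .
      then have "real (card (sym_diff T Z)) \<le> R\<^sup>2"
        by (intro sqrt_le_D) simp
      then show ?thesis by linarith
    qed
  qed simp
qed

theorem corollary7p14:
  fixes G :: "('a, 'b) monoid_scheme" and d\<^sub>G :: "'a \<Rightarrow> 'a \<Rightarrow> real"
  shows "(group G \<and> finite (carrier G) \<and> carrier G \<noteq> {\<one>\<^bsub>G\<^esub>} \<and> Metric_space (carrier G) d\<^sub>G \<longrightarrow>
      \<not> Metric_space.coarsely_amenable
          (SIGMA n:{1..}. carrier (group_power G n))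
          (coarse_union_dist (\<lambda>n. carrier (group_power G n)) (\<lambda>n. l1_dist n d\<^sub>G))) \<and>
    (separable_space (euclidean :: 'h::{real_inner, complete_space} topology) \<and>
      \<not> (\<exists>B :: 'h set. finite B \<and> span B = UNIV) \<longrightarrow>
      \<not> Metric_space.coarsely_amenable (UNIV :: 'h set) dist)"
proof (intro conjI impI; elim conjE)
  assume G: "group G" "finite (carrier G)" "carrier G \<noteq> {\<one>\<^bsub>G\<^esub>}"
    and d: "Metric_space (carrier G) d\<^sub>G"
  have one: "\<one>\<^bsub>G\<^esub> \<in> carrier G" using G(1) by (simp add: group.is_monoid)
  then obtain g where g: "g \<in> carrier G" "\<one>\<^bsub>G\<^esub> \<noteq> g" using G(3) by blast
  show "\<not> Metric_space.coarsely_amenable (SIGMA n:{1..}. carrier (group_power G n))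
      (coarse_union_dist (\<lambda>n. carrier (group_power G n)) (\<lambda>n. l1_dist n d\<^sub>G))"
    using powers_not_coarsely_amenable[OF G(2) d one g]
    by (simp add: group_power_def)
next
  assume "\<not> (\<exists>B :: 'h set. finite B \<and> span B = UNIV)"
  then show "\<not> Metric_space.coarsely_amenable (UNIV :: 'h set) dist"
    by (rule infinite_dim_not_coarsely_amenable)
qed

end
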